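(* Let $\mathcal{H}$ be a Hilbert space, let $S$ be a completely nonunitary isometry on $\mathcal{H}$, and let $A$ be a bounded linear operator on $\mathcal{H}$. If $A\propto S$, then the point spectrum of $A^*$ contains the open unit disc.
   Context: Hilbert spaces are complex. For bounded linear operators $A,B$ on a Hilbert space $\mathcal{H}$, $A\propto B$ means that there is a nonzero bounded linear operator $X$ on $\mathcal{H}$ with $XA=BX$. An isometry $S$ on $\mathcal{H}$ is completely nonunitary if the unitary part in its Wold decomposition is trivial, i.e. $\bigcap_{n=0}^\infty S^n(\mathcal{H})=\{0\}$; equivalently, $\mathcal{H}$ is the orthogonal direct sum $\sum_{n=0}^\infty\oplus S^n(\mathcal{W})$ where $\mathcal{W}=\ker S^*$. The point spectrum of an operator is its set of eigenvalues. *)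

theory Defs
  imports "HOL-Analysis.Analysis"
begin

text \<open>
  A complex inner product space is a real normed space carrying a compatible complex scalar
  multiplication and a sesquilinear form that induces the norm. The form is linear in the first
  argument, hence conjugate linear in the second; its positive definiteness follows from
  \<open>cinner_self\<close> and the norm axioms.
\<close>

class complex_inner = real_normed_vector +
  fixes scaleC :: "complex \<Rightarrow> 'a \<Rightarrow> 'a"  (infixr \<open>*\<^sub>C\<close> 75)
    and cinner :: "'a \<Rightarrow> 'a \<Rightarrow> complex"
  assumes scaleC_add_right: "c *\<^sub>C (x + y) = c *\<^sub>C x + c *\<^sub>C y"
    and scaleC_add_left: "(c + d) *\<^sub>C x = c *\<^sub>C x + d *\<^sub>C x"
    and scaleC_scaleC: "c *\<^sub>C d *\<^sub>C x = (c * d) *\<^sub>C x"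
    and scaleC_of_real: "complex_of_real r *\<^sub>C x = r *\<^sub>R x"
    and cinner_commute: "cinner x y = cnj (cinner y x)"
    and cinner_add_left: "cinner (x + y) z = cinner x z + cinner y z"
    and cinner_scaleC_left: "cinner (c *\<^sub>C x) y = c * cinner x y"
    and cinner_self: "cinner x x = complex_of_real ((norm x)\<^sup>2)"

class chilbert_space = complex_inner + complete_space

instantiation complex :: chilbert_space
begin

definition scaleC_complex :: "complex \<Rightarrow> complex \<Rightarrow> complex"
  where "scaleC_complex c x = c * x"

definition cinner_complex :: "complex \<Rightarrow> complex \<Rightarrow> complex"
  where "cinner_complex x y = x * cnj y"

instance
proof
  fix x :: complex
  show "cinner x x = complex_of_real ((norm x)\<^sup>2)"
    unfolding cinner_complex_def by (rule complex_norm_square [symmetric])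
qed (simp_all add: scaleC_complex_def cinner_complex_def scaleR_conv_of_real ring_distribs)

end

definition bounded_clinear :: "('a::complex_inner \<Rightarrow> 'b::complex_inner) \<Rightarrow> bool"
  where "bounded_clinear T \<longleftrightarrow> bounded_linear T \<and> (\<forall>c x. T (c *\<^sub>C x) = c *\<^sub>C T x)"

text \<open>
  For a bounded operator on a Hilbert space the description below determines a unique function,
  by the Riesz representation theorem; for other arguments the value is unspecified.
\<close>

definition cadjoint :: "('a::chilbert_space \<Rightarrow> 'a) \<Rightarrow> 'a \<Rightarrow> 'a"
  where "cadjoint T = (THE T'. \<forall>x y. cinner (T x) y = cinner x (T' y))"

definition point_spectrum :: "('a::complex_inner \<Rightarrow> 'a) \<Rightarrow> complex set"
  where "point_spectrum T = {l. \<exists>x. x \<noteq> 0 \<and> T x = l *\<^sub>C x}"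

definition isometry :: "('a::complex_inner \<Rightarrow> 'a) \<Rightarrow> bool"
  where "isometry S \<longleftrightarrow> bounded_clinear S \<and> (\<forall>x. norm (S x) = norm x)"

definition completely_nonunitary :: "('a::complex_inner \<Rightarrow> 'a) \<Rightarrow> bool"
  where "completely_nonunitary S \<longleftrightarrow> isometry S \<and> (\<Inter>n. range (S ^^ n)) = {0}"

definition intertwines :: "('a::complex_inner \<Rightarrow> 'a) \<Rightarrow> ('a \<Rightarrow> 'a) \<Rightarrow> bool"  (infix \<open>\<propto>\<close> 50)
  where "A \<propto> B \<longleftrightarrow> (\<exists>X. bounded_clinear X \<and> X \<noteq> (\<lambda>x. 0) \<and> X \<circ> A = B \<circ> X)"

end

theory Submission
  imports Defs
begin

text \<open>
  Let \<open>X A = S X\<close> with \<open>X \<noteq> 0\<close>, let \<open>\<bar>l\<bar> < 1\<close>, and put \<open>\<mu> = cnj l\<close>. The closure \<open>K\<close> of the range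
  of \<open>X\<close> is a nonzero closed subspace invariant under \<open>S\<close>. The key point is that \<open>S - \<mu>\<close> does
  not map \<open>K\<close> onto itself. If it did, then a short norm computation shows that \<open>S\<close> itself would
  map \<open>K\<close> onto \<open>K\<close> (\<open>isometry_onto_if_translate_onto\<close>), so \<open>K\<close> would lie in the range of every
  \<open>S ^^ n\<close>, which a completely nonunitary \<open>S\<close> forbids.

  Since \<open>S - \<mu>\<close> is bounded below, its image of \<open>K\<close> is closed, and so some nonzero \<open>f\<close> in \<open>K\<close> is
  orthogonal to it (\<open>orthogonal_to_translate_exists\<close>). For every \<open>h\<close>,
  \<open>0 = cinner ((S - \<mu>) (X h)) f = cinner (X ((A - \<mu>) h)) f\<close>, so the adjoint of \<open>X\<close> sends \<open>f\<close> to
  a solution of \<open>A\<^sup>* y = l y\<close>. It is nonzero, for otherwise \<open>f\<close> would be orthogonal to the range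
  of \<open>X\<close>, hence to \<open>K\<close> and to itself.

  The Hilbert space tools behind this are the existence of nearest points in closed subspaces,
  which supplies the orthogonal vectors, and the existence of adjoints, which follows from it as
  in the Riesz representation theorem.
\<close>

section \<open>Complex inner product spaces\<close>

lemma scaleC_zero_right: "c *\<^sub>C (0::'a::complex_inner) = 0"
  using scaleC_add_right[of c 0 "0::'a"] by simp

lemma scaleC_minus_right: "c *\<^sub>C (- x) = - (c *\<^sub>C (x::'a::complex_inner))"
  using scaleC_add_right[of c x "- x"] by (simp add: scaleC_zero_right eq_neg_iff_add_eq_0 add.commute)

lemma scaleC_diff_right: "c *\<^sub>C (x - y) = c *\<^sub>C x - c *\<^sub>C (y::'a::complex_inner)"
  using scaleC_add_right[of c x "- y"] by (simp add: scaleC_minus_right)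

lemma scaleC_scaleR: "c *\<^sub>C (r *\<^sub>R x) = r *\<^sub>R (c *\<^sub>C (x::'a::complex_inner))"
  unfolding scaleC_of_real[symmetric] scaleC_scaleC by (simp add: mult.commute)

lemma cinner_add_right: "cinner x (y + z) = cinner x y + cinner x (z::'a::complex_inner)"
  by (metis cinner_add_left cinner_commute complex_cnj_add)

lemma cinner_scaleC_right: "cinner x (c *\<^sub>C y) = cnj c * cinner x (y::'a::complex_inner)"
  by (metis cinner_commute cinner_scaleC_left complex_cnj_mult)

lemma cinner_zero_left: "cinner 0 (y::'a::complex_inner) = 0"
  using cinner_add_left[of 0 0 y] by simp

lemma cinner_zero_right: "cinner x (0::'a::complex_inner) = 0"
  using cinner_add_right[of x 0 0] by simp

lemma cinner_minus_left: "cinner (- x) y = - cinner x (y::'a::complex_inner)"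
  using cinner_add_left[of x "- x" y] by (simp add: cinner_zero_left eq_neg_iff_add_eq_0 add.commute)

lemma cinner_minus_right: "cinner x (- y) = - cinner x (y::'a::complex_inner)"
  using cinner_add_right[of x y "- y"] by (simp add: cinner_zero_right eq_neg_iff_add_eq_0 add.commute)

lemma cinner_diff_left: "cinner (x - y) z = cinner x z - cinner y (z::'a::complex_inner)"
  using cinner_add_left[of x "- y" z] by (simp add: cinner_minus_left)

lemma cinner_diff_right: "cinner x (y - z) = cinner x y - cinner x (z::'a::complex_inner)"
  using cinner_add_right[of x y "- z"] by (simp add: cinner_minus_right)

lemma cinner_self_eq_0_iff: "cinner x x = 0 \<longleftrightarrow> x = (0::'a::complex_inner)"
  by (simp add: cinner_self)

lemma cinner_eqI: "(\<And>x. cinner x y = cinner x z) \<Longrightarrow> y = (z::'a::complex_inner)"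
  by (metis cinner_diff_right cinner_self_eq_0_iff eq_iff_diff_eq_0)

lemma norm_add_power2:
  "(norm (x + y))\<^sup>2 = (norm x)\<^sup>2 + 2 * Re (cinner x y) + (norm (y::'a::complex_inner))\<^sup>2"
proof -
  have "cinner (x + y) (x + y) = cinner x x + cinner x y + cnj (cinner x y) + cinner y y"
    using cinner_commute[of y x] by (simp add: cinner_add_left cinner_add_right)
  from arg_cong[OF this, of Re] show ?thesis
    by (simp add: cinner_self)
qed

lemma norm_diff_power2:
  "(norm (x - y))\<^sup>2 = (norm x)\<^sup>2 - 2 * Re (cinner x y) + (norm (y::'a::complex_inner))\<^sup>2"
  using norm_add_power2[of x "- y"] by (simp add: cinner_minus_right)

lemma norm_scaleC: "norm (c *\<^sub>C x) = cmod c * norm (x::'a::complex_inner)"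
proof -
  have "complex_of_real ((norm (c *\<^sub>C x))\<^sup>2) = c * cnj c * cinner x x"
    unfolding cinner_self[symmetric] by (simp add: cinner_scaleC_left cinner_scaleC_right)
  also have "\<dots> = complex_of_real ((cmod c * norm x)\<^sup>2)"
    by (simp add: complex_norm_square[symmetric] cinner_self power_mult_distrib)
  finally show ?thesis
    by (metis mult_nonneg_nonneg norm_ge_zero of_real_eq_iff power2_eq_imp_eq)
qed

lemma bounded_linear_scaleC: "bounded_linear (\<lambda>x::'a::complex_inner. c *\<^sub>C x)"
  by (rule bounded_linear_intro[where K = "cmod c"])
    (simp_all add: scaleC_add_right scaleC_scaleR norm_scaleC)

text \<open>
  By polarization the inner product is a polynomial in norms, since its imaginary part is the
  real part for \<open>\<i> y\<close> in place of \<open>y\<close>.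
\<close>

lemma continuous_on_cinner_left: "continuous_on UNIV (\<lambda>x::'a::complex_inner. cinner x y)"
proof -
  have Re: "Re (cinner x z) = ((norm (x + z))\<^sup>2 - (norm x)\<^sup>2 - (norm z)\<^sup>2) / 2" for x z :: 'a
    by (simp add: norm_add_power2)
  have "Im (cinner x y) = Re (cinner x (\<i> *\<^sub>C y))" for x
    by (simp add: cinner_scaleC_right)
  then have "cinner x y = Complex (((norm (x + y))\<^sup>2 - (norm x)\<^sup>2 - (norm y)\<^sup>2) / 2)
      (((norm (x + \<i> *\<^sub>C y))\<^sup>2 - (norm x)\<^sup>2 - (norm (\<i> *\<^sub>C y))\<^sup>2) / 2)" for x
    by (simp add: complex_eq_iff Re)
  then show ?thesis
    by (simp add: Complex_eq) (intro continuous_intros ballI zero_neq_numeral[symmetric])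
qed

lemma closed_orthogonal: "closed {x::'a::complex_inner. cinner x y = 0}"
  using continuous_closed_vimage[of "{0}" "\<lambda>x. cinner x y"] continuous_on_cinner_left[of y]
  by (simp add: vimage_def continuous_on_eq_continuous_at)


section \<open>Orthogonal projection and adjoints\<close>

definition csubspace :: "'a::complex_inner set \<Rightarrow> bool"
  where "csubspace K \<longleftrightarrow> subspace K \<and> (\<forall>c. \<forall>x\<in>K. c *\<^sub>C x \<in> K)"

lemma csubspace_image:
  assumes "bounded_clinear T" "csubspace K"
  shows "csubspace (T ` K)"
proof -
  have "linear T"
    using assms(1) by (simp add: bounded_clinear_def bounded_linear.linear)
  then have "subspace (T ` K)"
    using assms(2) by (simp add: csubspace_def linear_subspace_image)
  moreover have "c *\<^sub>C T x = T (c *\<^sub>C x)" for c x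
    using assms(1) by (simp add: bounded_clinear_def)
  ultimately show ?thesis
    using assms(2) by (auto simp: csubspace_def)
qed

lemma csubspace_UNIV: "csubspace UNIV"
  by (simp add: csubspace_def)

lemma csubspace_closure:
  assumes "csubspace K"
  shows "csubspace (closure K)"
proof -
  have "c *\<^sub>C x \<in> closure K" if "x \<in> closure K" for c x
  proof -
    have "(\<lambda>x. c *\<^sub>C x) ` closure K \<subseteq> closure K"
      using assms closure_subset[of K]
      by (intro image_closure_subset linear_continuous_on bounded_linear_scaleC closed_closure)
        (auto simp: csubspace_def)
    with that show ?thesis by blast
  qed
  moreover have "x + y \<in> closure K" if xy: "x \<in> closure K" "y \<in> closure K" for x y
  proof -
    obtain u v where "\<forall>n. u n \<in> K" "u \<longlonglongrightarrow> x" "\<forall>n. v n \<in> K" "v \<longlonglongrightarrow> y"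
      using xy unfolding closure_sequential by blast
    then have "\<forall>n. u n + v n \<in> K" "(\<lambda>n. u n + v n) \<longlonglongrightarrow> x + y"
      using assms by (auto simp: csubspace_def subspace_add intro: tendsto_add)
    then show ?thesis
      unfolding closure_sequential by (intro exI conjI)
  qed
  moreover have "0 \<in> closure K"
    using assms closure_subset[of K] by (auto simp: csubspace_def subspace_0)
  ultimately show ?thesis
    unfolding csubspace_def subspace_def by (metis scaleC_of_real)
qed

text \<open>
  The parallelogram law makes every minimizing sequence of the distance from \<open>x\<close> to \<open>K\<close> a Cauchy
  sequence.
\<close>

lemma nearest_point_exists:
  fixes x :: "'a::chilbert_space"
  assumes "subspace K" "closed K"
  obtains p where "p \<in> K" "\<And>k. k \<in> K \<Longrightarrow> norm (x - p) \<le> norm (x - k)"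
proof -
  define D where "D = (INF k\<in>K. (norm (x - k))\<^sup>2)"
  have ne: "K \<noteq> {}"
    using assms(1) subspace_0 by blast
  have bdd: "bdd_below ((\<lambda>k. (norm (x - k))\<^sup>2) ` K)"
    by (rule bdd_belowI[of _ 0]) auto
  have D_le: "D \<le> (norm (x - k))\<^sup>2" if "k \<in> K" for k
    unfolding D_def using bdd that by (rule cINF_lower)
  have "\<exists>k\<in>K. (norm (x - k))\<^sup>2 < D + 1 / real (Suc n)" for n
    using cINF_less_iff[OF ne bdd, of "D + 1 / real (Suc n)"] by (simp add: D_def)
  then obtain y where yK: "\<And>n. y n \<in> K"
    and y: "\<And>n. (norm (x - y n))\<^sup>2 < D + 1 / real (Suc n)"
    by metis
  have gap: "(norm (y m - y n))\<^sup>2 \<le> 2 / real (Suc m) + 2 / real (Suc n)" for m n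
  proof -
    \<comment> \<open>The midpoint of \<open>y m\<close> and \<open>y n\<close> lies in \<open>K\<close>, so its squared distance to \<open>x\<close> is at least \<open>D\<close>.\<close>
    let ?c = "(1/2::real) *\<^sub>R (y m + y n)"
    have "?c \<in> K"
      using assms(1) yK by (simp add: subspace_add subspace_scale)
    then have "D \<le> (norm (x - ?c))\<^sup>2"
      by (rule D_le)
    moreover have "(x - y m) + (x - y n) = 2 *\<^sub>R (x - ?c)"
      by (simp add: algebra_simps scaleR_2)
    then have "(norm ((x - y m) + (x - y n)))\<^sup>2 = 4 * (norm (x - ?c))\<^sup>2"
      by (simp add: power_mult_distrib)
    moreover have "(norm (y m - y n))\<^sup>2 = (norm ((x - y n) - (x - y m)))\<^sup>2"
      by simp
    ultimately show ?thesis
      using norm_add_power2[of "x - y m" "x - y n"] norm_diff_power2[of "x - y m" "x - y n"]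
        y[of m] y[of n]
      by (simp add: norm_minus_commute)
  qed
  have "Cauchy y"
  proof (rule CauchyI)
    fix e :: real assume "0 < e"
    then obtain N where N: "4 / e\<^sup>2 < real N"
      using reals_Archimedean2 by blast
    have "norm (y m - y n) < e" if "N \<le> m" "N \<le> n" for m n
    proof -
      have inv: "2 / real (Suc k) \<le> 2 / real (Suc N)" if "N \<le> k" for k
        using that by (intro divide_left_mono) auto
      have "(norm (y m - y n))\<^sup>2 \<le> 4 / real (Suc N)"
        using gap[of m n] inv[OF that(1)] inv[OF that(2)] by simp
      also have "\<dots> < e\<^sup>2"
        using N \<open>0 < e\<close> by (simp add: field_simps) (smt (verit) zero_less_power)
      finally show ?thesis
        using \<open>0 < e\<close> by (simp add: power2_less_imp_less)
    qed
    then show "\<exists>M. \<forall>m\<ge>M. \<forall>n\<ge>M. norm (y m - y n) < e"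
      by blast
  qed
  then obtain p where p: "y \<longlonglongrightarrow> p"
    by (auto simp: Cauchy_convergent_iff convergent_def)
  show ?thesis
  proof
    show "p \<in> K"
      using assms(2) yK p closed_sequentially by blast
    have "(\<lambda>n. (norm (x - y n))\<^sup>2) \<longlonglongrightarrow> (norm (x - p))\<^sup>2"
      by (intro tendsto_intros p)
    moreover have "(\<lambda>n. D + 1 / real (Suc n)) \<longlonglongrightarrow> D"
      using tendsto_add[OF tendsto_const LIMSEQ_Suc[OF lim_1_over_n]] by simp
    ultimately have "(norm (x - p))\<^sup>2 \<le> D"
      by (rule LIMSEQ_le) (use y less_imp_le in blast)
    then show "norm (x - p) \<le> norm (x - k)" if "k \<in> K" for k
      using D_le[OF that] by (simp add: power2_le_imp_le)
  qed
qed

text \<open>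
  The vector is \<open>x - p\<close> for a nearest point \<open>p\<close>: a nonzero inner product with some \<open>k\<close> would
  let a multiple of \<open>k\<close> bring \<open>p\<close> closer to \<open>x\<close>.
\<close>

lemma orthogonal_vector_exists:
  fixes K L :: "'a::chilbert_space set"
  assumes L: "csubspace L" "closed L" and K: "subspace K" and sub: "L \<subset> K"
  obtains f where "f \<in> K" "f \<noteq> 0" "\<And>k. k \<in> L \<Longrightarrow> cinner k f = 0"
proof -
  obtain x where x: "x \<in> K" "x \<notin> L"
    using sub by blast
  obtain p where p: "p \<in> L" and near: "\<And>k. k \<in> L \<Longrightarrow> norm (x - p) \<le> norm (x - k)"
    using nearest_point_exists L unfolding csubspace_def by metis
  let ?f = "x - p"
  have "cinner k ?f = 0" if k: "k \<in> L" for k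
  proof (cases "k = 0")
    case True
    then show ?thesis by (simp add: cinner_zero_left)
  next
    case False
    define t where "t = cinner ?f k"
    \<comment> \<open>\<open>c k\<close> is the projection of \<open>x - p\<close> onto the line through \<open>k\<close>.\<close>
    define c where "c = t / complex_of_real ((norm k)\<^sup>2)"
    have "p + c *\<^sub>C k \<in> L"
      using L(1) p k by (simp add: csubspace_def subspace_add)
    then have "norm ?f \<le> norm (?f - c *\<^sub>C k)"
      using near[of "p + c *\<^sub>C k"] by (simp add: algebra_simps)
    then have "(norm ?f)\<^sup>2 \<le> (norm (?f - c *\<^sub>C k))\<^sup>2"
      by (rule power_mono) simp
    also have "\<dots> = (norm ?f)\<^sup>2 - 2 * Re (cnj c * t) + (cmod c * norm k)\<^sup>2"
      by (simp add: norm_diff_power2 cinner_scaleC_right norm_scaleC t_def)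
    also have "Re (cnj c * t) = (cmod t)\<^sup>2 / (norm k)\<^sup>2"
      by (simp add: c_def cmod_power2 complex_cnj_divide) (simp add: power2_eq_square add_divide_distrib)
    also have "(cmod c * norm k)\<^sup>2 = (cmod t)\<^sup>2 / (norm k)\<^sup>2"
      using False by (simp add: c_def norm_divide norm_mult power2_eq_square)
    finally have "(cmod t)\<^sup>2 / (norm k)\<^sup>2 \<le> 0"
      by simp
    then have "t = 0"
      using False by (simp add: divide_le_0_iff)
    then show ?thesis
      using cinner_commute[of k ?f] by (simp add: t_def)
  qed
  moreover have "?f \<in> K" "?f \<noteq> 0"
    using x p sub K by (auto intro: subspace_diff)
  ultimately show ?thesis
    using that by blast
qed

text \<open>
  If the functional \<open>x \<mapsto> cinner (T x) y\<close> is nonzero, its closed kernel has a nonzero orthogonal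
  vector \<open>f\<close>, and a multiple of \<open>f\<close> represents the functional.
\<close>

lemma adjoint_value_exists:
  fixes T :: "'a::chilbert_space \<Rightarrow> 'b::complex_inner"
  assumes T: "bounded_clinear T"
  shows "\<exists>z. \<forall>x. cinner (T x) y = cinner x z"
proof (cases "\<forall>x. cinner (T x) y = 0")
  case True
  then show ?thesis by (metis cinner_zero_right)
next
  case False
  interpret T: bounded_linear T
    using T by (simp add: bounded_clinear_def)
  have Tc: "T (c *\<^sub>C x) = c *\<^sub>C T x" for c x
    using T by (simp add: bounded_clinear_def)
  let ?L = "{x. cinner (T x) y = 0}"
  have "csubspace ?L"
    using scaleC_of_real[of _ "T _"]
    by (auto simp: csubspace_def subspace_def T.add T.zero T.scaleR Tc cinner_add_left
        cinner_zero_left cinner_scaleC_left) (metis cinner_scaleC_left mult_zero_right)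
  moreover have "closed ?L"
    using continuous_closed_vimage[OF closed_orthogonal[of y], of T] T.isCont[OF continuous_ident]
    by (simp add: vimage_def)
  moreover have "?L \<subset> UNIV"
    using False by blast
  ultimately obtain f where f: "f \<noteq> 0" and orth: "\<And>k. k \<in> ?L \<Longrightarrow> cinner k f = 0"
    using orthogonal_vector_exists[of ?L UNIV] by (metis subspace_UNIV)
  define \<phi> where "\<phi> x = cinner (T x) y" for x
  define z where "z = cnj (\<phi> f / cinner f f) *\<^sub>C f"
  have \<phi>f: "\<phi> f \<noteq> 0"
    using orth[of f] f by (auto simp: \<phi>_def cinner_self_eq_0_iff)
  have "\<phi> x = cinner x z" for x
  proof -
    have "\<phi> (x - (\<phi> x / \<phi> f) *\<^sub>C f) = 0"
      using \<phi>f by (simp add: \<phi>_def T.diff Tc cinner_diff_left cinner_scaleC_left)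
    then have "cinner (x - (\<phi> x / \<phi> f) *\<^sub>C f) f = 0"
      using orth by (simp add: \<phi>_def)
    then have "cinner x f = \<phi> x / \<phi> f * cinner f f"
      by (simp add: cinner_diff_left cinner_scaleC_left)
    then show ?thesis
      using \<phi>f f by (simp add: z_def cinner_scaleC_right cinner_self_eq_0_iff)
  qed
  then show ?thesis
    by (auto simp: \<phi>_def)
qed

lemma cinner_cadjoint:
  assumes "bounded_clinear T"
  shows "cinner (T x) y = cinner x (cadjoint T y)"
proof -
  obtain T' where T': "\<forall>x y. cinner (T x) y = cinner x (T' y)"
    using adjoint_value_exists[OF assms] by metis
  have "cadjoint T = T'"
    unfolding cadjoint_def
  proof (rule the_equality, rule T')
    fix U assume U: "\<forall>x y. cinner (T x) y = cinner x (U y)"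
    show "U = T'"
      by (rule ext, rule cinner_eqI) (metis T' U)
  qed
  with T' show ?thesis by simp
qed


section \<open>Invariant subspaces of completely nonunitary isometries\<close>

lemma bounded_clinear_minus_scaleC:
  assumes "bounded_clinear S"
  shows "bounded_clinear (\<lambda>x. S x - \<mu> *\<^sub>C x)"
  using assms bounded_linear_sub[OF _ bounded_linear_scaleC, of S \<mu>]
  by (simp add: bounded_clinear_def scaleC_diff_right scaleC_scaleC mult.commute)

lemma closed_image_bounded_below:
  fixes T :: "'a::chilbert_space \<Rightarrow> 'a"
  assumes "bounded_clinear T" "0 < e" "\<And>x. e * norm x \<le> norm (T x)" "csubspace K" "closed K"
  shows "closed (T ` K)"
proof -
  have "complete (T ` K)"
    using assms complete_isometric_image[of e K T]
    by (auto simp: bounded_clinear_def csubspace_def complete_eq_closed mult.commute)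
  then show ?thesis
    by (rule complete_imp_closed)
qed

text \<open>
  A vector \<open>w\<close> of \<open>K\<close> orthogonal to \<open>S ` K\<close> has the form \<open>S v - \<mu> v\<close> with \<open>v\<close> in \<open>K\<close>. Then
  \<open>S v\<close> is orthogonal to \<open>w\<close>, so \<open>\<mu> v = S v - w\<close> gives
  \<open>\<bar>\<mu>\<bar>\<^sup>2 \<parallel>v\<parallel>\<^sup>2 = \<parallel>v\<parallel>\<^sup>2 + \<parallel>w\<parallel>\<^sup>2\<close>, which forces \<open>v = 0\<close> and hence \<open>w = 0\<close>.
\<close>

lemma isometry_onto_if_translate_onto:
  fixes S :: "'a::chilbert_space \<Rightarrow> 'a"
  assumes S: "isometry S" and K: "csubspace K" "closed K" and inv: "S ` K \<subseteq> K"
    and \<mu>: "cmod \<mu> < 1" and onto: "(\<lambda>x. S x - \<mu> *\<^sub>C x) ` K = K"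
  shows "S ` K = K"
proof (rule ccontr)
  assume "S ` K \<noteq> K"
  with inv have "S ` K \<subset> K" by blast
  have bS: "bounded_clinear S" and nS: "\<And>x. norm (S x) = norm x"
    using S by (auto simp: isometry_def)
  have "csubspace (S ` K)" "closed (S ` K)"
    using csubspace_image[OF bS K(1)] closed_image_bounded_below[OF bS _ _ K, of 1] nS by auto
  moreover have "subspace K"
    using K by (simp add: csubspace_def)
  ultimately obtain w where w: "w \<in> K" "w \<noteq> 0" and orth: "\<And>k. k \<in> S ` K \<Longrightarrow> cinner k w = 0"
    using orthogonal_vector_exists \<open>S ` K \<subset> K\<close> by metis
  obtain v where v: "v \<in> K" "w = S v - \<mu> *\<^sub>C v"
    using w(1) onto by blast
  have "\<mu> *\<^sub>C v = S v - w"
    using v(2) by simp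
  then have "(cmod \<mu> * norm v)\<^sup>2 = (norm (S v - w))\<^sup>2"
    by (metis norm_scaleC)
  also have "\<dots> = (norm v)\<^sup>2 + (norm w)\<^sup>2"
    using orth[of "S v"] v(1) by (simp add: norm_diff_power2 nS)
  finally have "(cmod \<mu> * norm v)\<^sup>2 = (norm v)\<^sup>2 + (norm w)\<^sup>2" .
  moreover have "(cmod \<mu> * norm v)\<^sup>2 \<le> (norm v)\<^sup>2"
    using \<mu> by (intro power_mono mult_left_le_one_le) auto
  ultimately show False
    using w(2) by simp
qed

text \<open>
  If \<open>S - \<mu>\<close> mapped \<open>K\<close> onto itself, so would \<open>S\<close>, and \<open>K\<close> would lie in the range of every
  power of \<open>S\<close>. Since \<open>S - \<mu>\<close> is bounded below by \<open>1 - \<bar>\<mu>\<bar>\<close>, the proper subspace onto which it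
  maps \<open>K\<close> is closed.
\<close>

lemma orthogonal_to_translate_exists:
  fixes S :: "'a::chilbert_space \<Rightarrow> 'a"
  assumes S: "completely_nonunitary S" and K: "csubspace K" "closed K" "K \<noteq> {0}"
    and inv: "S ` K \<subseteq> K" and \<mu>: "cmod \<mu> < 1"
  obtains f where "f \<in> K" "f \<noteq> 0" "\<And>k. k \<in> K \<Longrightarrow> cinner (S k - \<mu> *\<^sub>C k) f = 0"
proof -
  define T where "T = (\<lambda>x. S x - \<mu> *\<^sub>C x)"
  have iso: "isometry S" and bS: "bounded_clinear S" and nS: "\<And>x. norm (S x) = norm x"
    using S by (auto simp: completely_nonunitary_def isometry_def)
  have bT: "bounded_clinear T"
    unfolding T_def by (rule bounded_clinear_minus_scaleC[OF bS])
  have lower: "(1 - cmod \<mu>) * norm x \<le> norm (T x)" for x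
    using norm_triangle_ineq2[of "S x" "\<mu> *\<^sub>C x"] by (simp add: T_def norm_scaleC nS algebra_simps)
  have "T ` K \<subseteq> K"
    using K(1) inv by (auto simp: T_def csubspace_def intro!: subspace_diff)
  moreover have "T ` K \<noteq> K"
  proof
    assume "T ` K = K"
    then have SK: "S ` K = K"
      using isometry_onto_if_translate_onto[OF iso K(1,2) inv \<mu>] by (simp add: T_def)
    have "(S ^^ n) ` K = K" for n
      by (induction n) (simp, metis SK funpow.simps(2) image_comp)
    then have "K \<subseteq> (\<Inter>n. range (S ^^ n))"
      by blast
    then have "K \<subseteq> {0}"
      using S by (simp add: completely_nonunitary_def)
    moreover have "0 \<in> K"
      using K(1) by (simp add: csubspace_def subspace_0)
    ultimately show False
      using K(3) by blast
  qed
  moreover have "csubspace (T ` K)" "closed (T ` K)"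
    using csubspace_image[OF bT K(1)] closed_image_bounded_below[OF bT _ lower K(1,2)] \<mu> by auto
  ultimately obtain f where "f \<in> K" "f \<noteq> 0" "\<And>k. k \<in> T ` K \<Longrightarrow> cinner k f = 0"
    using orthogonal_vector_exists[of "T ` K" K] K(1) unfolding csubspace_def by (metis psubsetI)
  then show ?thesis
    using that by (auto simp: T_def)
qed


section \<open>Eigenvectors of the adjoint\<close>

theorem theorem6p1:
  fixes S A :: "'a::chilbert_space \<Rightarrow> 'a"
  assumes "isometry S" and "completely_nonunitary S"
    and "bounded_clinear A"
    and "A \<propto> S"
  shows "ball 0 1 \<subseteq> point_spectrum (cadjoint A)"
proof
  fix l :: complex assume "l \<in> ball 0 1"
  then have l: "cmod (cnj l) < 1" by simp
  obtain X where X: "bounded_clinear X" "X \<noteq> (\<lambda>x. 0)" "X \<circ> A = S \<circ> X"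
    using assms(4) by (auto simp: intertwines_def)
  have XA: "X (A h) = S (X h)" for h
    using X(3) by (metis comp_apply)
  interpret S: bounded_linear S
    using assms(1) by (simp add: isometry_def bounded_clinear_def)
  interpret X: bounded_linear X
    using X(1) by (simp add: bounded_clinear_def)
  define K where "K = closure (range X)"
  have XK: "X h \<in> K" for h
    using closure_subset[of "range X"] by (auto simp: K_def)
  have K: "csubspace K" "closed K"
    unfolding K_def by (auto intro: csubspace_closure csubspace_image[OF X(1) csubspace_UNIV])
  have "K \<noteq> {0}"
    using X(2) XK by auto
  moreover have "S ` K \<subseteq> K"
    unfolding K_def
  proof (rule image_closure_subset)
    show "continuous_on (closure (range X)) S"
      by (rule linear_continuous_on[OF S.bounded_linear_axioms])
    show "S ` range X \<subseteq> closure (range X)"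
      using XK by (auto simp: K_def XA[symmetric])
  qed simp
  ultimately obtain f where f: "f \<in> K" "f \<noteq> 0"
    and orth: "\<And>k. k \<in> K \<Longrightarrow> cinner (S k - cnj l *\<^sub>C k) f = 0"
    using orthogonal_to_translate_exists[OF assms(2) K _ _ l] by metis
  let ?y = "cadjoint X f"
  have "?y \<noteq> 0"
  proof
    assume "?y = 0"
    then have "range X \<subseteq> {z. cinner z f = 0}"
      using cinner_cadjoint[OF X(1), of _ f] by (auto simp: cinner_zero_right)
    then have "K \<subseteq> {z. cinner z f = 0}"
      unfolding K_def by (rule closure_minimal[OF _ closed_orthogonal])
    then show False
      using f by (auto simp: cinner_self_eq_0_iff)
  qed
  moreover have "cadjoint A ?y = l *\<^sub>C ?y"
  proof (rule cinner_eqI)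
    fix h
    have "cinner h (cadjoint A ?y) = cinner (S (X h)) f"
      by (simp add: cinner_cadjoint[OF assms(3), symmetric] cinner_cadjoint[OF X(1), symmetric] XA)
    also have "\<dots> = cnj l * cinner (X h) f"
      using orth[OF XK, of h] by (simp add: cinner_diff_left cinner_scaleC_left)
    also have "\<dots> = cinner h (l *\<^sub>C ?y)"
      by (simp add: cinner_scaleC_right cinner_cadjoint[OF X(1)])
    finally show "cinner h (cadjoint A ?y) = cinner h (l *\<^sub>C ?y)" .
  qed
  ultimately show "l \<in> point_spectrum (cadjoint A)"
    by (auto simp: point_spectrum_def)
qed

end
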